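(* Let $H$ be a real Hilbert space and $f:H\to\mathbb{R}\cup\{+\infty\}$ a lower semicontinuous proper convex function with $\inf f=0$. The following statements are equivalent: (i) There exist $r_0>0$ and $\varphi\in\mathcal{K}(0,r_0)$ such that $\|\partial(\varphi\circ f)(x)\|_-\ge1$ for all $x\in[0<f\le r_0]$. (ii) There exists a concave function $\psi\in\mathcal{K}(0,\infty)$ such that $\|\partial(\psi\circ f)(x)\|_-\ge1$ for all $x\notin[f=0]$.
   Context: $\partial g$ denotes the Fréchet subdifferential: $p\in\partial g(x)$ ($x\in\operatorname{dom}g$) iff $\liminf_{y\to x,y\ne x}\frac{g(y)-g(x)-\langle p,y-x\rangle}{\|y-x\|}\ge0$, and $\partial g(x)=\emptyset$ outside $\operatorname{dom}g$. $\|C\|_-=\inf\{\|p\|:p\in C\}$, equal to $+\infty$ if $C=\emptyset$. $\mathcal{K}(0,\bar r)$ ($\bar r\in(0,+\infty]$): functions $\varphi\in C([0,\bar r))\cap C^1(0,\bar r)$ with $\varphi(0)=0$ and $\varphi'>0$ on $(0,\bar r)$. $[0<f\le r_0]=\{x:0<f(x)\le r_0\}$. *)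

theory Defs
  imports "HOL-Analysis.Analysis" "HOL-Library.Extended_Real"
begin

definition edom :: "('a \<Rightarrow> ereal) \<Rightarrow> 'a set" where
  "edom g = {x. \<bar>g x\<bar> \<noteq> \<infinity>}"

definition lsc_ext :: "('a::topological_space \<Rightarrow> ereal) \<Rightarrow> bool" where
  "lsc_ext f \<longleftrightarrow> (\<forall>x. f x \<le> Liminf (at x) f)"

definition proper_ext :: "('a \<Rightarrow> ereal) \<Rightarrow> bool" where
  "proper_ext f \<longleftrightarrow> (\<exists>x. f x < \<infinity>) \<and> (\<forall>x. f x > -\<infinity>)"

definition convex_ext :: "('a::real_vector \<Rightarrow> ereal) \<Rightarrow> bool" where
  "convex_ext f \<longleftrightarrow> (\<forall>x y t. 0 < t \<and> t < 1 \<longrightarrow>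
      f ((1 - t) *\<^sub>R x + t *\<^sub>R y) \<le> ereal (1 - t) * f x + ereal t * f y)"

definition frechet_subdiff :: "('a::real_inner \<Rightarrow> ereal) \<Rightarrow> 'a \<Rightarrow> 'a set" where
  "frechet_subdiff g x =
     (if x \<in> edom g then
        {p. Liminf (at x) (\<lambda>y. (g y - g x - ereal (inner p (y - x))) / ereal (norm (y - x))) \<ge> 0}
      else {})"

text \<open>Lower norm ||C||_- = inf of norms, +\<infinity> for the empty set.\<close>
definition lower_norm :: "'a::real_normed_vector set \<Rightarrow> ereal" where
  "lower_norm C = (INF p\<in>C. ereal (norm p))"

definition classK :: "ereal \<Rightarrow> (real \<Rightarrow> real) \<Rightarrow> bool" where
  "classK rb \<phi> \<longleftrightarrow>
     continuous_on {t. 0 \<le> t \<and> ereal t < rb} \<phi> \<and>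
     (\<forall>t. 0 < t \<and> ereal t < rb \<longrightarrow> \<phi> differentiable (at t)) \<and>
     continuous_on {t. 0 < t \<and> ereal t < rb} (deriv \<phi>) \<and>
     \<phi> 0 = 0 \<and>
     (\<forall>t. 0 < t \<and> ereal t < rb \<longrightarrow> deriv \<phi> t > 0)"

text \<open>Composition \<phi> \<circ> f for \<phi> defined on [0, rb): value +\<infinity> whenever f x is not in [0, rb).\<close>
definition compK :: "(real \<Rightarrow> real) \<Rightarrow> ereal \<Rightarrow> ('a \<Rightarrow> ereal) \<Rightarrow> 'a \<Rightarrow> ereal" where
  "compK \<phi> rb f x = (if 0 \<le> f x \<and> f x < rb \<and> f x \<noteq> \<infinity> then ereal (\<phi> (real_of_ereal (f x))) else \<infinity>)"

end

theory Submission
  imports Defs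
begin

text \<open>For an increasing differentiable \<open>\<phi>\<close>, the Frechet subgradients of \<open>\<phi> \<circ> f\<close> at a point of value
  r are exactly the multiples by \<open>\<phi>' r\<close> of the convex subgradients of f, so the inequality says
  that every subgradient at level r has norm at least \<open>1 / \<phi>' r\<close>. By convexity, projecting a point
  on a lower sublevel set produces there a subgradient of no larger norm. Hence the inequality
  at level r holds with \<open>\<phi>' s\<close> for every \<open>s \<le> r\<close>, and \<open>\<phi>'\<close> may be replaced by the infimum of
  \<open>\<phi>'\<close> over all lower levels. This infimum is decreasing and continuous, and it can be frozen beyond some
  level below \<open>r0\<close>; its antiderivative is the concave global function.\<close>

section \<open>Frechet subgradients of a composition and convex subgradients\<close>

text \<open>This is the subgradient of convex analysis, a global affine minorant, as opposed to the
  local limit in \<open>frechet_subdiff\<close>. Finiteness of \<open>f x\<close> is not built in;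
  the lemmas supply it through \<open>f x = ereal r\<close>.\<close>

definition subgradient :: "('a::real_inner \<Rightarrow> ereal) \<Rightarrow> 'a \<Rightarrow> 'a \<Rightarrow> bool" where
  "subgradient f x p \<longleftrightarrow> (\<forall>z. f x + ereal (p \<bullet> (z - x)) \<le> f z)"

text \<open>Clearing the positive denominator turns the lower limit into local affine minorants with
  error \<open>e * norm (y - x)\<close>, which removes quotients of extended reals from all later
  arguments.\<close>

lemma frechet_subdiff_iff:
  fixes g :: "'a::real_inner \<Rightarrow> ereal"
  assumes gx: "g x = ereal v"
  shows "p \<in> frechet_subdiff g x \<longleftrightarrow>
    (\<forall>e>0. \<forall>\<^sub>F y in at x. ereal (v + p \<bullet> (y - x) - e * norm (y - x)) \<le> g y)"
proof -
  let ?Q = "\<lambda>y. (g y - g x - ereal (p \<bullet> (y - x))) / ereal (norm (y - x))"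
  have le_quot: "ereal (- e) \<le> ?Q y \<longleftrightarrow> ereal (v + p \<bullet> (y - x) - e * norm (y - x)) \<le> g y"
    if "y \<noteq> x" for y e
  proof -
    have n: "norm (y - x) > 0" using that by simp
    show ?thesis
    proof (cases "g y")
      case (real u)
      then show ?thesis using n gx by (simp add: field_simps)
    next
      case PInf
      then show ?thesis using n gx by simp
    next
      case MInf
      then show ?thesis using n gx by simp
    qed
  qed
  have "p \<in> frechet_subdiff g x \<longleftrightarrow> 0 \<le> Liminf (at x) ?Q"
    by (simp add: frechet_subdiff_def edom_def gx)
  also have "\<dots> \<longleftrightarrow> (\<forall>e>0. \<forall>\<^sub>F y in at x. ereal (- e) \<le> ?Q y)"
  proof (intro iffI allI impI)
    fix e :: real assume "0 \<le> Liminf (at x) ?Q" "e > 0"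
    then have "\<forall>\<^sub>F y in at x. ereal (- e) < ?Q y"
      by (auto simp: le_Liminf_iff)
    then show "\<forall>\<^sub>F y in at x. ereal (- e) \<le> ?Q y"
      by eventually_elim simp
  next
    assume *: "\<forall>e>0. \<forall>\<^sub>F y in at x. ereal (- e) \<le> ?Q y"
    show "0 \<le> Liminf (at x) ?Q"
      unfolding le_Liminf_iff
    proof (intro allI impI)
      fix C :: ereal assume "C < 0"
      then obtain c where c: "C < ereal c" "ereal c < 0"
        using ereal_dense2 by blast
      have "\<forall>\<^sub>F y in at x. ereal (- (- c)) \<le> ?Q y"
        using * c(2) by (simp del: minus_minus)
      then show "\<forall>\<^sub>F y in at x. C < ?Q y"
        by eventually_elim (use c(1) in simp)
    qed
  qed
  also have "\<dots> \<longleftrightarrow> (\<forall>e>0. \<forall>\<^sub>F y in at x. ereal (v + p \<bullet> (y - x) - e * norm (y - x)) \<le> g y)"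
  proof -
    have "(\<forall>\<^sub>F y in at x. ereal (- e) \<le> ?Q y) \<longleftrightarrow>
      (\<forall>\<^sub>F y in at x. ereal (v + p \<bullet> (y - x) - e * norm (y - x)) \<le> g y)" for e
      unfolding eventually_at_filter by (intro eventually_cong always_eventually) (auto simp: le_quot)
    then show ?thesis by simp
  qed
  finally show ?thesis .
qed

text \<open>On the segment from x to z, f lies below its chord, so by monotonicity the composition
  lies below \<phi> of the chord, whose right derivative at x is \<open>d * (w - r)\<close>. The
  Frechet inequality forces this derivative to be at least \<open>q \<bullet> (z - x)\<close>.
  Convexity thus turns local information into a global inequality.\<close>

lemma frechet_subdiff_compK_imp_subgradient:
  fixes f :: "'a::real_inner \<Rightarrow> ereal"
  assumes cvx: "convex_ext f" and nonneg: "\<And>z. 0 \<le> f z"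
    and fx: "f x = ereal r" "0 < r" "ereal r < rb"
    and der: "(\<phi> has_real_derivative d) (at r)" and d: "d > 0"
    and mono: "\<And>s t. 0 \<le> s \<Longrightarrow> s \<le> t \<Longrightarrow> ereal t < rb \<Longrightarrow> \<phi> s \<le> \<phi> t"
    and q: "q \<in> frechet_subdiff (compK \<phi> rb f) x"
  shows "subgradient f x (q /\<^sub>R d)"
  unfolding subgradient_def
proof
  fix z
  show "f x + ereal ((q /\<^sub>R d) \<bullet> (z - x)) \<le> f z"
  proof (cases "f z = \<infinity> \<or> z = x")
    case True
    then show ?thesis by auto
  next
    case False
    then obtain w where w: "f z = ereal w" "0 \<le> w"
      using nonneg[of z] by (cases "f z") auto
    have zx: "z \<noteq> x" using False by simp
    have gx: "compK \<phi> rb f x = ereal (\<phi> r)"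
      using fx by (simp add: compK_def)
    let ?y = "\<lambda>t. x + t *\<^sub>R (z - x)"
    let ?m = "\<lambda>t. r + t * (w - r)"
    have toy: "filterlim ?y (at x) (at_right 0)"
    proof (rule filterlim_atI)
      show "(?y \<longlongrightarrow> x) (at_right 0)"
        by (rule tendsto_eq_intros refl | simp)+
      show "\<forall>\<^sub>F t in at_right 0. ?y t \<noteq> x"
        using eventually_at_right_less[of "0::real"] by eventually_elim (use zx in simp)
    qed
    have lim: "((\<lambda>t. (\<phi> (?m t) - \<phi> r) / t) \<longlongrightarrow> d * (w - r)) (at_right 0)"
    proof -
      have "((\<lambda>t. \<phi> (?m t)) has_real_derivative d * (w - r)) (at 0)"
        by (rule DERIV_chain2[where f = \<phi> and g = ?m])
          (use der in \<open>auto intro!: derivative_eq_intros\<close>)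
      then have "((\<lambda>t. (\<phi> (?m t) - \<phi> r) / t) \<longlongrightarrow> d * (w - r)) (at 0)"
        by (simp add: DERIV_def)
      then show ?thesis by (rule tendsto_mono[rotated]) (simp add: at_le)
    qed
    \<comment> \<open>For small t the chord stays below \<open>rb\<close>, so that
      \<open>compK\<close> takes its finite value on the segment and \<open>mono\<close>
      applies.\<close>
    have mlim: "((\<lambda>t. ereal (?m t)) \<longlongrightarrow> ereal r) (at_right 0)"
      by (intro tendsto_ereal) (rule tendsto_eq_intros refl | simp)+
    have bound: "q \<bullet> (z - x) - e * norm (z - x) \<le> d * (w - r)" if e: "e > 0" for e
    proof (rule tendsto_lowerbound[OF lim])
      have "\<forall>\<^sub>F y in at x. ereal (\<phi> r + q \<bullet> (y - x) - e * norm (y - x)) \<le> compK \<phi> rb f y"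
        using q e by (simp add: frechet_subdiff_iff[where g = "compK \<phi> rb f" and x = x, OF gx])
      then have ev: "\<forall>\<^sub>F t in at_right 0.
          ereal (\<phi> r + q \<bullet> (?y t - x) - e * norm (?y t - x)) \<le> compK \<phi> rb f (?y t)"
        by (rule eventually_compose_filterlim[OF _ toy])
      show "\<forall>\<^sub>F t in at_right 0. q \<bullet> (z - x) - e * norm (z - x) \<le> (\<phi> (?m t) - \<phi> r) / t"
        using ev eventually_at_right_less[of "0::real"]
          eventually_at_right_real[of 0 "1::real", simplified]
          order_tendstoD(2)[OF mlim fx(3)]
      proof eventually_elim
        case (elim t)
        then have t: "0 < t" "t < 1" by auto
        have "?y t = (1 - t) *\<^sub>R x + t *\<^sub>R z" by (simp add: algebra_simps)
        then have "f (?y t) \<le> ereal (1 - t) * f x + ereal t * f z"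
          using cvx t by (simp add: convex_ext_def)
        then have le: "f (?y t) \<le> ereal (?m t)"
          using fx w by (simp add: algebra_simps)
        then obtain u where u: "f (?y t) = ereal u" "0 \<le> u" "u \<le> ?m t"
          using nonneg[of "?y t"] by (cases "f (?y t)") auto
        have "ereal u < rb" using u elim(4) by (meson ereal_less_eq(3) le_less_trans)
        then have "compK \<phi> rb f (?y t) = ereal (\<phi> u)"
          using u by (simp add: compK_def)
        moreover have "\<phi> u \<le> \<phi> (?m t)" using mono u elim(4) by blast
        ultimately have "\<phi> r + t * (q \<bullet> (z - x)) - e * (t * norm (z - x)) \<le> \<phi> (?m t)"
          using elim(1) t by simp
        then show ?case using t by (simp add: field_simps)
      qed
    qed simp
    have "((\<lambda>e. q \<bullet> (z - x) - e * norm (z - x)) \<longlongrightarrow> q \<bullet> (z - x)) (at_right 0)"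
      by (rule tendsto_eq_intros refl | simp)+
    then have "q \<bullet> (z - x) \<le> d * (w - r)"
      by (rule tendsto_upperbound)
        (use eventually_at_right_less[of "0::real"] bound in \<open>auto elim: eventually_mono\<close>)
    then show ?thesis using d fx w by (simp add: field_simps)
  qed
qed

text \<open>Monotonicity carries the affine minorant of f to a minorant of the composition, namely
  \<phi> of an affine function; by the chain rule its gradient at x is
  \<open>d *\<^sub>R p\<close>.\<close>

lemma subgradient_imp_frechet_subdiff_compK:
  fixes f :: "'a::real_inner \<Rightarrow> ereal"
  assumes nonneg: "\<And>z. 0 \<le> f z"
    and fx: "f x = ereal r" "0 < r" "ereal r < rb"
    and der: "(\<phi> has_real_derivative d) (at r)"
    and mono: "\<And>s t. 0 \<le> s \<Longrightarrow> s \<le> t \<Longrightarrow> ereal t < rb \<Longrightarrow> \<phi> s \<le> \<phi> t"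
    and p: "subgradient f x p"
  shows "d *\<^sub>R p \<in> frechet_subdiff (compK \<phi> rb f) x"
proof -
  have gx: "compK \<phi> rb f x = ereal (\<phi> r)"
    using fx by (simp add: compK_def)
  let ?m = "\<lambda>y. r + p \<bullet> (y - x)"
  have "((\<lambda>y. \<phi> (?m y)) has_derivative (\<lambda>h. d * (p \<bullet> h))) (at x)"
  proof -
    have "(\<phi> has_derivative (*) d) (at (?m x))"
      using der by (simp add: has_field_derivative_def)
    moreover have "(?m has_derivative (\<lambda>h. p \<bullet> h)) (at x)"
      by (auto intro!: derivative_eq_intros)
    ultimately show ?thesis using has_derivative_compose by fastforce
  qed
  then have deriv_bound: "\<forall>\<^sub>F y in at x. norm (\<phi> (?m y) - \<phi> (?m x) - d * (p \<bullet> (y - x))) \<le> e * norm (y - x)"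
    if "e > 0" for e
    using that by (auto simp: has_derivative_within_alt2)
  \<comment> \<open>Near x the affine minorant stays positive, hence in the range where
    \<open>mono\<close> compares values of \<phi>.\<close>
  have mlim: "(?m \<longlongrightarrow> r) (at x)"
    by (rule tendsto_eq_intros refl | simp)+
  show ?thesis
    unfolding frechet_subdiff_iff[where g = "compK \<phi> rb f" and x = x, OF gx]
  proof (intro allI impI)
    fix e :: real assume "e > 0"
    show "\<forall>\<^sub>F y in at x. ereal (\<phi> r + d *\<^sub>R p \<bullet> (y - x) - e * norm (y - x)) \<le> compK \<phi> rb f y"
      using deriv_bound[OF \<open>e > 0\<close>] order_tendstoD(1)[OF mlim fx(2)]
    proof eventually_elim
      case (elim y)
      have le: "ereal (?m y) \<le> f y"
        using p fx by (simp add: subgradient_def)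
      show ?case
      proof (cases "f y < rb \<and> f y \<noteq> \<infinity>")
        case True
        then obtain u where u: "f y = ereal u" "?m y \<le> u"
          using nonneg[of y] le by (cases "f y") auto
        then have "\<phi> (?m y) \<le> \<phi> u" using mono elim(2) True by force
        then show ?thesis using elim u True nonneg[of y] by (simp add: compK_def)
      next
        case False
        then show ?thesis by (auto simp: compK_def)
      qed
    qed
  qed
qed

section \<open>Projection on closed convex sets in a Hilbert space\<close>

text \<open>A minimizing sequence for the squared distance is Cauchy by the parallelogram law, so
  completeness replaces compactness.\<close>

lemma closest_point_exists_complete:
  fixes S :: "'a::{real_inner, complete_space} set"
  assumes "closed S" "convex S" "S \<noteq> {}"
  obtains y where "y \<in> S" "\<And>z. z \<in> S \<Longrightarrow> norm (x - y) \<le> norm (x - z)"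
proof -
  define D where "D = (INF z\<in>S. (norm (x - z))\<^sup>2)"
  have bdd: "bdd_below ((\<lambda>z. (norm (x - z))\<^sup>2) ` S)"
    by (rule bdd_belowI2[of _ 0]) simp
  have D_le: "D \<le> (norm (x - z))\<^sup>2" if "z \<in> S" for z
    unfolding D_def using bdd that by (rule cINF_lower)
  have "\<exists>z\<in>S. (norm (x - z))\<^sup>2 < D + inverse (real (Suc n))" for n
    using cINF_less_iff[OF assms(3) bdd, of "D + inverse (real (Suc n))"]
    by (simp add: D_def)
  then obtain y where y: "\<And>n. y n \<in> S" "\<And>n. (norm (x - y n))\<^sup>2 < D + inverse (real (Suc n))"
    by metis
  \<comment> \<open>Parallelogram law: the midpoint lies in S, so its squared distance to x is at
    least D, while those of \<open>y m\<close> and \<open>y n\<close> barely exceed D.\<close>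
  have para: "(norm (y m - y n))\<^sup>2 \<le> 2 * inverse (real (Suc m)) + 2 * inverse (real (Suc n))" for m n
  proof -
    have "(1/2) *\<^sub>R y m + (1/2) *\<^sub>R y n \<in> S"
      using assms(2) y(1) by (simp add: convex_def)
    then have "4 * D \<le> 4 * (norm (x - ((1/2) *\<^sub>R y m + (1/2) *\<^sub>R y n)))\<^sup>2"
      using D_le by simp
    also have "\<dots> = 2 * (norm (x - y m))\<^sup>2 + 2 * (norm (x - y n))\<^sup>2 - (norm (y m - y n))\<^sup>2"
      by (simp add: power2_norm_eq_inner inner_diff_left inner_diff_right inner_add_left
          inner_add_right inner_commute algebra_simps)
    finally show ?thesis using y(2)[of m] y(2)[of n] by linarith
  qed
  have "Cauchy y"
  proof (rule metric_CauchyI)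
    fix e :: real assume "e > 0"
    then have "e\<^sup>2 / 4 > 0" by simp
    then obtain N where N: "inverse (real (Suc N)) < e\<^sup>2 / 4"
      using reals_Archimedean by blast
    show "\<exists>M. \<forall>m\<ge>M. \<forall>n\<ge>M. dist (y m) (y n) < e"
    proof (intro exI allI impI)
      fix m n assume mn: "N \<le> m" "N \<le> n"
      then have "inverse (real (Suc m)) \<le> inverse (real (Suc N))"
        "inverse (real (Suc n)) \<le> inverse (real (Suc N))"
        by (auto intro!: le_imp_inverse_le)
      then have "(norm (y m - y n))\<^sup>2 < e\<^sup>2" using para[of m n] N by linarith
      then show "dist (y m) (y n) < e"
        using \<open>e > 0\<close> by (auto simp: dist_norm intro: power2_less_imp_less)
    qed
  qed
  then obtain l where l: "y \<longlonglongrightarrow> l"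
    using convergent_eq_Cauchy by blast
  have "l \<in> S" using assms(1) l y(1) closed_sequentially by blast
  moreover have "(norm (x - l))\<^sup>2 \<le> D"
  proof (rule LIMSEQ_le)
    show "(\<lambda>n. (norm (x - y n))\<^sup>2) \<longlonglongrightarrow> (norm (x - l))\<^sup>2"
      by (intro tendsto_intros l)
    show "(\<lambda>n. D + inverse (real (Suc n))) \<longlonglongrightarrow> D"
      using tendsto_add[OF tendsto_const LIMSEQ_inverse_real_of_nat, of D] by simp
    show "\<exists>N. \<forall>n\<ge>N. (norm (x - y n))\<^sup>2 \<le> D + inverse (real (Suc n))"
      using y(2) by (auto intro: less_imp_le)
  qed
  ultimately show ?thesis
    using D_le by (meson norm_ge_zero order_trans power2_le_imp_le that)
qed

text \<open>Moving from y towards z by a fraction t stays in S and cannot shorten the distance to x.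
  Expanding the square, dividing by t and letting t tend to 0 leaves the first-order term.\<close>

lemma closest_point_inner_le:
  fixes S :: "'a::real_inner set"
  assumes "convex S" "y \<in> S" "z \<in> S"
    and closest: "\<And>w. w \<in> S \<Longrightarrow> norm (x - y) \<le> norm (x - w)"
  shows "(x - y) \<bullet> (z - y) \<le> 0"
proof -
  have "2 * ((x - y) \<bullet> (z - y)) \<le> t * (norm (z - y))\<^sup>2" if t: "0 < t" "t < 1" for t :: real
  proof -
    have "(1 - t) *\<^sub>R y + t *\<^sub>R z \<in> S"
      using assms(1-3) t by (simp add: convex_alt)
    then have "(norm (x - y))\<^sup>2 \<le> (norm (x - ((1 - t) *\<^sub>R y + t *\<^sub>R z)))\<^sup>2"
      using closest by (simp add: power_mono)
    also have "x - ((1 - t) *\<^sub>R y + t *\<^sub>R z) = (x - y) - t *\<^sub>R (z - y)"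
      by (simp add: algebra_simps)
    also have "(norm \<dots>)\<^sup>2 = (norm (x - y))\<^sup>2 - t * (2 * ((x - y) \<bullet> (z - y))) + t * (t * (norm (z - y))\<^sup>2)"
      unfolding power2_norm_eq_inner inner_diff_left[of "x - y"] inner_diff_right[of _ "x - y"]
      by (simp add: inner_commute[of "z - y" "x - y"])
    finally have "t * (2 * ((x - y) \<bullet> (z - y))) \<le> t * (t * (norm (z - y))\<^sup>2)" by simp
    then show ?thesis using t by simp
  qed
  then have ev: "\<forall>\<^sub>F t in at_right 0. 2 * ((x - y) \<bullet> (z - y)) \<le> t * (norm (z - y))\<^sup>2"
    using eventually_at_right_real[of 0 "1::real"] by (auto elim!: eventually_mono)
  have "((\<lambda>t. t * (norm (z - y))\<^sup>2) \<longlongrightarrow> 0) (at_right 0)"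
    by (rule tendsto_eq_intros refl | simp)+
  then have "2 * ((x - y) \<bullet> (z - y)) \<le> 0"
    by (rule tendsto_lowerbound[OF _ ev]) simp
  then show ?thesis by simp
qed

section \<open>Sublevel sets and subgradients at lower levels\<close>

lemma lsc_ext_closed_sublevel:
  fixes f :: "'a::topological_space \<Rightarrow> ereal"
  assumes "lsc_ext f"
  shows "closed {x. f x \<le> c}"
  unfolding closed_limpt
proof (intro allI impI)
  fix x assume lp: "x islimpt {x. f x \<le> c}"
  show "x \<in> {x. f x \<le> c}"
  proof (rule ccontr)
    assume "x \<notin> {x. f x \<le> c}"
    then have "c < f x" by simp
    then have "\<forall>\<^sub>F y in at x. c < f y"
      using assms by (auto simp: lsc_ext_def le_Liminf_iff)
    moreover have "\<exists>\<^sub>F y in at x. f y \<le> c"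
      using lp by (simp add: islimpt_conv_frequently_at)
    ultimately show False
      by (simp add: frequently_def not_le)
  qed
qed

lemma convex_ext_sublevel:
  assumes "convex_ext f"
  shows "convex {x. f x \<le> ereal c}"
  unfolding convex_alt
proof (clarsimp)
  fix x y and u :: real
  assume xy: "f x \<le> ereal c" "f y \<le> ereal c" and u: "0 \<le> u" "u \<le> 1"
  show "f ((1 - u) *\<^sub>R x + u *\<^sub>R y) \<le> ereal c"
  proof (cases "u = 0 \<or> u = 1")
    case True
    then show ?thesis using xy by auto
  next
    case False
    then have u: "0 < u" "u < 1" using u by auto
    have "f ((1 - u) *\<^sub>R x + u *\<^sub>R y) \<le> ereal (1 - u) * f x + ereal u * f y"
      using assms u by (simp add: convex_ext_def)
    also have "\<dots> \<le> ereal (1 - u) * ereal c + ereal u * ereal c"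
      using u xy by (intro add_mono ereal_mult_left_mono) auto
    finally show ?thesis by (simp add: algebra_simps)
  qed
qed

text \<open>With y the projection of x on the sublevel set, the hyperplane through y orthogonal to
  x - y separates it from x; the slope of the supporting affine function is the supremum of the
  slopes admissible on the side of the sublevel set, and x itself bounds it from above.\<close>

lemma subgradient_at_lower_level:
  fixes f :: "'a::{real_inner, complete_space} \<Rightarrow> ereal"
  assumes lsc: "lsc_ext f" and cvx: "convex_ext f" and nonneg: "\<And>z. 0 \<le> f z"
    and low: "f w0 < ereal s" and fx: "f x = ereal r" and sr: "s < r"
    and p: "subgradient f x p"
  obtains y q where "f y = ereal s" "subgradient f y q" "norm q \<le> norm p"
proof -
  let ?S = "{z. f z \<le> ereal s}"
  have S: "closed ?S" "convex ?S" "?S \<noteq> {}"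
    using lsc_ext_closed_sublevel[OF lsc] convex_ext_sublevel[OF cvx] low by (auto intro: less_imp_le)
  obtain y where y: "y \<in> ?S" and closest: "\<And>z. z \<in> ?S \<Longrightarrow> norm (x - y) \<le> norm (x - z)"
    using closest_point_exists_complete[OF S] by blast
  have convR: "f ((1 - t) *\<^sub>R a + t *\<^sub>R b) \<le> ereal ((1 - t) * u + t * v)"
    if "0 < t" "t < 1" "f a = ereal u" "f b = ereal v" for t a b u v
    using cvx[unfolded convex_ext_def, rule_format, of t a b] that by simp
  have finite: "\<exists>u. f z = ereal u \<and> 0 \<le> u" if "f z \<noteq> \<infinity>" for z
    using nonneg[of z] that by (cases "f z") auto
  have xy: "x \<noteq> y" using y fx sr by auto
  \<comment> \<open>Affine coordinate along \<open>x - y\<close>: zero at y, positive at x, and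
    nonpositive on the sublevel set by the projection inequality.\<close>
  define a where "a z = (x - y) \<bullet> (z - y)" for z
  have a_comb: "a ((1 - t) *\<^sub>R z + t *\<^sub>R z') = (1 - t) * a z + t * a z'" for t z z'
    by (simp add: a_def algebra_simps inner_diff_right inner_add_right)
  have ax: "a x = (norm (x - y))\<^sup>2" by (simp add: a_def power2_norm_eq_inner)
  have ax_pos: "a x > 0" using xy ax by simp
  have a_S: "a z \<le> 0" if "f z \<le> ereal s" for z
    unfolding a_def using closest_point_inner_le[OF S(2) y _ closest] that by simp
  \<comment> \<open>If \<open>a z\<close> were nonnegative, the segment from z to x would contain a
    point of the sublevel set with positive coordinate, against \<open>a_S\<close>. The fraction t
    below is where the chord from u to r has height s.\<close>
  have a_low: "a z < 0" if lt: "f z < ereal s" for z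
  proof (rule ccontr)
    assume "\<not> a z < 0"
    obtain u where u: "f z = ereal u" "u < s"
      using lt nonneg[of z] by (cases "f z") auto
    define t where "t = (s - u) / (r - u)"
    have t: "0 < t" "t < 1" using u sr by (auto simp: t_def field_simps)
    have "t * (r - u) = s - u" using u sr by (simp add: t_def)
    then have "(1 - t) * u + t * r = s" by (simp add: algebra_simps)
    then have "f ((1 - t) *\<^sub>R z + t *\<^sub>R x) \<le> ereal s"
      using convR[OF t u(1) fx] by simp
    then have "(1 - t) * a z + t * a x \<le> 0" using a_S a_comb by metis
    moreover have "(1 - t) * a z + t * a x > 0"
      using t ax_pos \<open>\<not> a z < 0\<close> by (intro add_nonneg_pos mult_nonneg_nonneg) auto
    ultimately show False by simp
  qed
  have fy: "f y = ereal s"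
    using a_low[of y] y by (fastforce simp: a_def)
  \<comment> \<open>A slope l along a works at a point w with value \<open>u < s\<close> exactly
    when \<open>s + l * a w \<le> u\<close>, that is, when l is at least this quotient, because
    \<open>a w\<close> is negative.\<close>
  define A where "A = {(s - u) / (- a w) | w u. f w = ereal u \<and> u < s}"
  have cross: "(s - u) / (- a w) \<le> (v - s) / a z"
    if w: "f w = ereal u" "u < s" and z: "f z = ereal v" "a z > 0" for w u z v
  proof -
    have aw: "a w < 0" using a_low w by simp
    \<comment> \<open>The segment from w to z meets the hyperplane \<open>a = 0\<close> at this t;
      there f is at least s by \<open>a_low\<close>, and the chord inequality compares the two
      slopes.\<close>
    define t where "t = - a w / (a z - a w)"
    have t: "0 < t" "t < 1" using aw z by (auto simp: t_def field_simps)
    have t': "t * (a z - a w) = - a w" using aw z by (simp add: t_def)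
    then have "a ((1 - t) *\<^sub>R w + t *\<^sub>R z) = 0" unfolding a_comb by (simp add: algebra_simps)
    then have "\<not> f ((1 - t) *\<^sub>R w + t *\<^sub>R z) < ereal s" using a_low by fastforce
    then have "s \<le> (1 - t) * u + t * v"
      using convR[OF t w(1) z(1)] by (meson ereal_less_eq(3) le_less_trans not_le)
    then have "(a z - a w) * s \<le> (a z - a w) * ((1 - t) * u + t * v)"
      using aw z by (intro mult_left_mono) auto
    also have "\<dots> = (a z - a w) * u + t * (a z - a w) * (v - u)" by (simp add: algebra_simps)
    also have "\<dots> = a z * u - a w * v" unfolding t' by (simp add: algebra_simps)
    finally have "a z * (s - u) \<le> (- a w) * (v - s)" by (simp add: algebra_simps)
    then show ?thesis using aw z by (simp add: divide_simps mult.commute split: if_splits)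
  qed
  obtain u0 where u0: "f w0 = ereal u0" "u0 < s"
    using low nonneg[of w0] by (cases "f w0") auto
  have A_ne: "A \<noteq> {}" using u0 by (auto simp: A_def)
  have A_bdd: "bdd_above A"
    by (rule bdd_aboveI[of _ "(r - s) / a x"]) (use cross fx ax_pos in \<open>auto simp: A_def\<close>)
  define l where "l = Sup A"
  have l_upper: "l \<le> (v - s) / a z" if "f z = ereal v" "a z > 0" for z v
    unfolding l_def by (rule cSup_least[OF A_ne]) (use cross that in \<open>auto simp: A_def\<close>)
  have l_lower: "(s - u) / (- a w) \<le> l" if "f w = ereal u" "u < s" for w u
    unfolding l_def by (rule cSup_upper[OF _ A_bdd]) (use that in \<open>auto simp: A_def\<close>)
  \<comment> \<open>The point \<open>w0\<close> strictly below level s makes l positive; this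
    settles points with \<open>a z \<le> 0\<close> and value at least s, and later the norm of the
    new subgradient.\<close>
  have "0 < (s - u0) / (- a w0)"
    using u0 a_low[of w0] low by (intro divide_pos_pos) auto
  then have l_pos: "l > 0" using l_lower[OF u0] by simp
  have "subgradient f y (l *\<^sub>R (x - y))"
    unfolding subgradient_def
  proof
    fix z
    show "f y + ereal (l *\<^sub>R (x - y) \<bullet> (z - y)) \<le> f z"
    proof (cases "f z = \<infinity>")
      case False
      then obtain v where v: "f z = ereal v" using finite by blast
      have "s + l * a z \<le> v"
      proof (cases "a z > 0")
        case True
        then show ?thesis using l_upper[OF v True] by (simp add: field_simps)
      next
        case False
        show ?thesis
        proof (cases "v < s")
          case True
          then show ?thesis using l_lower[OF v True] a_low[of z] v by (simp add: field_simps)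
        next
          case False
          moreover have "l * a z \<le> 0" using l_pos \<open>\<not> a z > 0\<close> by (simp add: mult_nonneg_nonpos)
          ultimately show ?thesis by simp
        qed
      qed
      then show ?thesis using v fy by (simp add: a_def)
    qed simp
  qed
  \<comment> \<open>Both slopes are compared through the drop \<open>r - s\<close>: it is at least
    \<open>l * (norm (x - y))\<^sup>2\<close> by the choice of l, and at most
    \<open>norm p * norm (x - y)\<close> by the subgradient inequality at x.\<close>
  moreover have "norm (l *\<^sub>R (x - y)) \<le> norm p"
  proof -
    have "l * norm (x - y) * norm (x - y) \<le> r - s"
      using l_upper[OF fx ax_pos] xy by (simp add: ax power2_eq_square field_simps)
    also have "\<dots> \<le> p \<bullet> (x - y)"
      using p[unfolded subgradient_def, rule_format, of y] fx fy
      by (simp add: inner_diff_right)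
    also have "\<dots> \<le> norm p * norm (x - y)" by (rule norm_cauchy_schwarz)
    finally show ?thesis using xy l_pos by simp
  qed
  ultimately show ?thesis using that fy by blast
qed

section \<open>Desingularizing functions and their concave replacement\<close>

lemma classK_deriv:
  assumes "classK rb \<phi>" "0 < t" "ereal t < rb"
  shows "(\<phi> has_real_derivative deriv \<phi> t) (at t)" "deriv \<phi> t > 0"
  using assms by (auto simp: classK_def DERIV_deriv_iff_real_differentiable)

lemma classK_mono:
  assumes K: "classK rb \<phi>" and st: "0 \<le> s" "s \<le> t" "ereal t < rb"
  shows "\<phi> s \<le> \<phi> t"
proof (cases "s = t")
  case False
  have below: "ereal u < rb" if "u \<le> t" for u
    using that st(3) by (meson ereal_less_eq(3) le_less_trans)
  have "\<phi> s < \<phi> t"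
  proof (rule DERIV_pos_imp_increasing_open[where f = \<phi>])
    show "s < t" using False st by simp
    show "\<exists>y. (\<phi> has_real_derivative y) (at u) \<and> 0 < y" if "s < u" "u < t" for u
      using classK_deriv[OF K, of u] that st below[of u] by auto
    show "continuous_on {s..t} \<phi>"
      by (rule continuous_on_subset[where s = "{t. 0 \<le> t \<and> ereal t < rb}"])
        (use K st below in \<open>auto simp: classK_def\<close>)
  qed
  then show ?thesis by simp
qed simp

text \<open>Shifting both points by \<open>e > 0\<close> moves them into the open half-line and
  shifts their convex combination by the same e; continuity allows e to tend to 0.\<close>

lemma concave_on_atLeast_if_continuous:
  fixes \<psi> :: "real \<Rightarrow> real"
  assumes conc: "concave_on {0<..} \<psi>" and cont: "continuous_on {0..} \<psi>"
  shows "concave_on {0..} \<psi>"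
  unfolding concave_on_iff
proof (intro conjI ballI allI impI)
  show "convex {0::real..}" by simp
  fix x y u v :: real
  assume xy: "x \<in> {0..}" "y \<in> {0..}" and uv: "0 \<le> u" "0 \<le> v" "u + v = 1"
  have lim: "((\<lambda>e. \<psi> (c + e)) \<longlongrightarrow> \<psi> c) (at_right 0)" if "0 \<le> c" for c
  proof -
    have "continuous (at 0 within {0..}) (\<lambda>e. \<psi> (c + e))"
    proof -
      have "continuous_on {0..} (\<lambda>e. \<psi> (c + e))"
        by (rule continuous_on_compose2[OF cont]) (use that in \<open>auto intro!: continuous_intros\<close>)
      then show ?thesis by (simp add: continuous_on_eq_continuous_within)
    qed
    then have "((\<lambda>e. \<psi> (c + e)) \<longlongrightarrow> \<psi> c) (at 0 within {0..})"
      by (simp add: continuous_within)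
    then show ?thesis by (rule tendsto_within_subset) auto
  qed
  show "u * \<psi> x + v * \<psi> y \<le> \<psi> (u *\<^sub>R x + v *\<^sub>R y)"
  proof (rule tendsto_le)
    show "((\<lambda>e. u * \<psi> (x + e) + v * \<psi> (y + e)) \<longlongrightarrow> u * \<psi> x + v * \<psi> y) (at_right 0)"
      using xy by (intro tendsto_intros lim) auto
    show "((\<lambda>e. \<psi> (u *\<^sub>R x + v *\<^sub>R y + e)) \<longlongrightarrow> \<psi> (u *\<^sub>R x + v *\<^sub>R y)) (at_right 0)"
      using xy uv by (intro lim) auto
    show "\<forall>\<^sub>F e in at_right 0. u * \<psi> (x + e) + v * \<psi> (y + e) \<le> \<psi> (u *\<^sub>R x + v *\<^sub>R y + e)"
      using eventually_at_right_less[of "0::real"]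
    proof eventually_elim
      case (elim e)
      have "u * \<psi> (x + e) + v * \<psi> (y + e) \<le> \<psi> (u *\<^sub>R (x + e) + v *\<^sub>R (y + e))"
        using conc xy uv elim unfolding concave_on_iff by auto
      also have "u *\<^sub>R (x + e) + v *\<^sub>R (y + e) = u *\<^sub>R x + v *\<^sub>R y + (u + v) * e"
        by (simp add: algebra_simps)
      finally show ?case using uv by simp
    qed
  qed simp
qed

text \<open>The derivative g of the concave function is the decreasing envelope of the derivative
  of \<open>\<phi>\<close>, frozen beyond a; adding 1 keeps it positive.\<close>

lemma classK_concave_from_lower_envelope:
  assumes K: "classK (ereal r0) \<phi>" and a: "0 < a" "a < r0"
  obtains \<psi> where "classK \<infinity> \<psi>" "concave_on {0..} \<psi>"
    "\<And>r. 0 < r \<Longrightarrow> deriv \<psi> r = 1 + (INF s\<in>{0<..min r a}. deriv \<phi> s)"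
proof -
  define c where "c r = (INF s\<in>{0<..r}. deriv \<phi> s)" for r
  define g where "g r = 1 + c (min r a)" for r
  have dpos: "deriv \<phi> s > 0" if "0 < s" "s \<le> a" for s
    using classK_deriv(2)[OF K, of s] that a by simp
  have bdd: "bdd_below (deriv \<phi> ` {0<..r})" if "r \<le> a" for r
    by (rule bdd_belowI2[of _ 0]) (use that dpos in \<open>auto intro: less_imp_le\<close>)
  have c_le: "c r \<le> deriv \<phi> s" if "0 < s" "s \<le> r" "r \<le> a" for r s
    unfolding c_def using bdd[OF that(3)] that by (intro cINF_lower) auto
  have c_ge: "m \<le> c r" if "0 < r" "\<And>s. 0 < s \<Longrightarrow> s \<le> r \<Longrightarrow> m \<le> deriv \<phi> s" for m r
    unfolding c_def using that by (intro cINF_greatest) auto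
  have c_anti: "c r' \<le> c r" if "0 < r" "r \<le> r'" "r' \<le> a" for r r'
    using that by (intro c_ge) (auto intro: c_le)
  have g_pos: "g r \<ge> 1" if "0 < r" for r
    unfolding g_def using c_ge[of "min r a" 0] dpos that a by (auto intro: less_imp_le)
  have g_anti: "g r' \<le> g r" if "0 < r" "r \<le> r'" for r r'
    unfolding g_def using c_anti[of "min r a" "min r' a"] that a by auto
  \<comment> \<open>Enlarging the interval from r to r' only adds values of the derivative that are
    at least \<open>deriv \<phi> r - e\<close>, hence at least \<open>c r - e\<close>.\<close>
  have c_osc: "c r \<le> c r' + e"
    if "0 < r" "r \<le> r'" "r' \<le> a" and osc: "\<And>s. r \<le> s \<Longrightarrow> s \<le> r' \<Longrightarrow> deriv \<phi> r \<le> deriv \<phi> s + e"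
      and "0 \<le> e" for r r' e
  proof -
    have "c r - e \<le> c r'"
    proof (rule c_ge)
      fix s assume s: "0 < s" "s \<le> r'"
      show "c r - e \<le> deriv \<phi> s"
      proof (cases "s \<le> r")
        case True
        then show ?thesis using c_le[of s r] that s by auto
      next
        case False
        then show ?thesis using c_le[of r r] that(1-3) osc[of s] s by auto
      qed
    qed (use that in auto)
    then show ?thesis by simp
  qed
  have g_cont: "isCont g r" if r: "0 < r" for r
    unfolding continuous_at_eps_delta
  proof (intro allI impI)
    fix e :: real assume "e > 0"
    let ?\<rho> = "min r a"
    \<comment> \<open>Since \<open>a < r0\<close>, the point \<open>min r a\<close> is interior to
      the interval where \<open>deriv \<phi>\<close> is continuous, also when r exceeds a.\<close>
    have "continuous_on {0<..<r0} (deriv \<phi>)"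
      using K unfolding classK_def by (elim conjE continuous_on_subset) auto
    then have "isCont (deriv \<phi>) ?\<rho>"
      using r a by (simp add: continuous_on_eq_continuous_at)
    \<comment> \<open>Two values within \<open>e / 3\<close> of the central one differ by less than
      \<open>2 * e / 3\<close>, which leaves room for the strict bound e. The radius
      \<open>min \<delta> r\<close> below also keeps r' positive.\<close>
    then obtain \<delta> where \<delta>: "\<delta> > 0"
      "\<And>s. \<bar>s - ?\<rho>\<bar> < \<delta> \<Longrightarrow> \<bar>deriv \<phi> s - deriv \<phi> ?\<rho>\<bar> < e / 3"
      unfolding continuous_at_eps_delta dist_real_def using \<open>e > 0\<close>
      by (metis divide_pos_pos zero_less_numeral)
    have "dist (g r') (g r) < e" if r': "dist r' r < min \<delta> r" for r'
    proof -
      let ?\<rho>' = "min r' a"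
      have pos: "0 < r'" using r' by (auto simp: dist_real_def)
      have near: "\<bar>?\<rho>' - ?\<rho>\<bar> < \<delta>" using r' by (auto simp: dist_real_def)
      have osc: "deriv \<phi> s \<le> deriv \<phi> s' + 2 * e / 3"
        if "min ?\<rho> ?\<rho>' \<le> s" "s \<le> max ?\<rho> ?\<rho>'" "min ?\<rho> ?\<rho>' \<le> s'" "s' \<le> max ?\<rho> ?\<rho>'" for s s'
      proof -
        have "\<bar>s - ?\<rho>\<bar> < \<delta>" "\<bar>s' - ?\<rho>\<bar> < \<delta>" using that near by linarith+
        then show ?thesis using \<delta>(2)[of s] \<delta>(2)[of s'] by linarith
      qed
      have "\<bar>c ?\<rho>' - c ?\<rho>\<bar> \<le> 2 * e / 3"
      proof (cases "?\<rho> \<le> ?\<rho>'")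
        case True
        have "c ?\<rho> \<le> c ?\<rho>' + 2 * e / 3"
          by (rule c_osc[OF _ True]) (use r a \<open>e > 0\<close> True osc in auto)
        then show ?thesis using c_anti[OF _ True] r a \<open>e > 0\<close> by auto
      next
        case False
        then have le: "?\<rho>' \<le> ?\<rho>" by linarith
        have "c ?\<rho>' \<le> c ?\<rho> + 2 * e / 3"
          by (rule c_osc[OF _ le]) (use pos a \<open>e > 0\<close> le osc in auto)
        then show ?thesis using c_anti[OF _ le] pos a \<open>e > 0\<close> by auto
      qed
      then show ?thesis using \<open>e > 0\<close> by (simp add: g_def dist_real_def)
    qed
    then show "\<exists>d>0. \<forall>r'. dist r' r < d \<longrightarrow> dist (g r') (g r) < e"
      using \<delta>(1) r by (intro exI[of _ "min \<delta> r"]) auto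
  qed
  \<comment> \<open>The integrand may be unbounded near 0, so the antiderivative is taken on the
    open half-line and normalized at 0 afterwards.\<close>
  obtain G where "\<forall>x::real. 0 < ereal x \<longrightarrow> ereal x < \<infinity> \<longrightarrow> (G has_vector_derivative g x) (at x)"
    using einterval_antiderivative[of 0 \<infinity> g] g_cont by auto
  then have G: "(G has_real_derivative g x) (at x)" if "0 < x" for x
    using that by (simp add: has_real_derivative_iff_has_vector_derivative)
  have G_mono: "G s \<le> G t" if "0 < s" "s \<le> t" for s t
  proof (rule DERIV_nonneg_imp_nondecreasing[OF that(2)])
    fix x assume "s \<le> x"
    then have "0 < x" using that by simp
    then show "\<exists>y. (G has_real_derivative y) (at x) \<and> 0 \<le> y"
      using G[of x] g_pos[of x] by (intro exI[of _ "g x"]) simp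
  qed
  \<comment> \<open>Integrability of g at 0: on (0, a] it is at most
    \<open>deriv \<phi> + 1\<close>, so \<open>G t - \<phi> t - t\<close> is nonincreasing there,
    and \<phi> is nonnegative.\<close>
  have G_lower: "G a - \<phi> a - a \<le> G t" if t: "0 < t" for t
  proof (cases "t \<le> a")
    case True
    have "G a - \<phi> a - a \<le> G t - \<phi> t - t"
    proof (rule DERIV_nonpos_imp_nonincreasing[OF True])
      fix x assume x: "t \<le> x" "x \<le> a"
      have "((\<lambda>x. G x - \<phi> x - x) has_real_derivative g x - deriv \<phi> x - 1) (at x)"
        using x t a by (intro derivative_intros G classK_deriv[OF K]) auto
      moreover have "g x - deriv \<phi> x - 1 \<le> 0"
        using c_le[of x x] x t by (simp add: g_def min_def)
      ultimately show "\<exists>y. ((\<lambda>x. G x - \<phi> x - x) has_real_derivative y) (at x) \<and> y \<le> 0" by blast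
    qed
    moreover have "0 \<le> \<phi> t"
      using classK_mono[OF K, of 0 t] K t True a by (simp add: classK_def)
    ultimately show ?thesis using t by linarith
  next
    case False
    moreover have "0 \<le> \<phi> a"
      using classK_mono[OF K, of 0 a] K a by (simp add: classK_def)
    ultimately show ?thesis using G_mono[of a t] a by linarith
  qed
  \<comment> \<open>As G is nondecreasing, L is its right limit at 0; subtracting it makes \<psi>
    continuous at 0 with value 0.\<close>
  define L where "L = (INF t\<in>{0<..}. G t)"
  have G_bdd: "bdd_below (G ` {0<..})"
    by (rule bdd_belowI2[of _ "G a - \<phi> a - a"]) (use G_lower in auto)
  have L_le: "L \<le> G t" if "0 < t" for t
    unfolding L_def using G_bdd that by (intro cINF_lower) auto
  define \<psi> where "\<psi> t = (if t \<le> 0 then 0 else G t - L)" for t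
  have \<psi>_deriv: "(\<psi> has_real_derivative g t) (at t)" if "0 < t" for t
  proof (rule DERIV_cong_ev[THEN iffD1])
    show "((\<lambda>t. G t - L) has_real_derivative g t) (at t)"
      using G[OF that] by (auto intro!: derivative_eq_intros)
    show "\<forall>\<^sub>F x in nhds t. G x - L = \<psi> x"
      using eventually_nhds_in_open[of "{0<..}" t] that
      by (auto elim!: eventually_mono simp: \<psi>_def)
  qed auto
  then have \<psi>_deriv_eq: "deriv \<psi> t = g t" if "0 < t" for t
    using that DERIV_imp_deriv by blast
  have cont0: "continuous (at 0 within {0..}) \<psi>"
    unfolding continuous_within_eps_delta
  proof (intro allI impI)
    fix e :: real assume "e > 0"
    then obtain t where t: "0 < t" "G t < L + e"
      using cINF_less_iff[OF _ G_bdd, of "L + e"] by (auto simp: L_def)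
    have "dist (\<psi> x) (\<psi> 0) < e" if "x \<in> {0..}" "dist x 0 < t" for x
      using that \<open>e > 0\<close> t L_le[of x] G_mono[of x t] by (auto simp: \<psi>_def dist_real_def)
    then show "\<exists>d>0. \<forall>x\<in>{0..}. dist x 0 < d \<longrightarrow> dist (\<psi> x) (\<psi> 0) < e"
      using t(1) by blast
  qed
  have cont: "continuous_on {0..} \<psi>"
    unfolding continuous_on_eq_continuous_within
  proof
    fix x :: real assume "x \<in> {0..}"
    then show "continuous (at x within {0..}) \<psi>"
      using cont0 \<psi>_deriv[of x, THEN DERIV_isCont] continuous_at_imp_continuous_at_within
      by (cases "x = 0") auto
  qed
  have "classK \<infinity> \<psi>"
    unfolding classK_def
  proof (intro conjI allI impI)
    show "continuous_on {t. 0 \<le> t \<and> ereal t < \<infinity>} \<psi>"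
      using cont by (simp add: atLeast_def)
    have "continuous_on {0<..} g"
      using g_cont by (auto intro: continuous_at_imp_continuous_on)
    then show "continuous_on {t. 0 < t \<and> ereal t < \<infinity>} (deriv \<psi>)"
      by (rule continuous_on_eq[THEN continuous_on_subset]) (auto simp: \<psi>_deriv_eq)
    show "\<psi> 0 = 0" by (simp add: \<psi>_def)
  next
    fix t assume "0 < t \<and> ereal t < \<infinity>"
    then have t: "0 < t" by simp
    show "\<psi> differentiable at t" using \<psi>_deriv[OF t] real_differentiable_def by blast
    show "0 < deriv \<psi> t" using \<psi>_deriv_eq[OF t] g_pos[OF t] by simp
  qed
  moreover have "concave_on {0..} \<psi>"
  proof (rule concave_on_atLeast_if_continuous[OF _ cont])
    have "convex_on {0<..} (\<lambda>t. - \<psi> t)"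
      by (rule convex_on_realI[where f' = "\<lambda>t. - g t"])
        (auto intro!: derivative_intros \<psi>_deriv g_anti)
    then show "concave_on {0<..} \<psi>" by (simp add: concave_on_def)
  qed
  ultimately show ?thesis
    using \<psi>_deriv_eq that by (auto simp: g_def c_def)
qed

section \<open>The equivalence\<close>

lemma one_le_lower_norm_iff: "1 \<le> lower_norm C \<longleftrightarrow> (\<forall>p\<in>C. 1 \<le> norm p)"
  by (simp add: lower_norm_def le_INF_iff)

text \<open>The composition is infinite at such a point. Hence any given Frechet subgradient forces
  \<open>f x < rb\<close>, which is how both directions obtain a real value of f.\<close>

lemma frechet_subdiff_compK_empty:
  assumes "\<not> f x < rb"
  shows "frechet_subdiff (compK \<phi> rb f) x = {}"
  using assms by (simp add: frechet_subdiff_def edom_def compK_def)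

theorem theorem4p4:
  fixes f :: "'a::{real_inner, complete_space} \<Rightarrow> ereal"
  assumes "lsc_ext f" and "proper_ext f" and "convex_ext f"
    and "(INF x. f x) = 0"
  shows "(\<exists>r0::real. r0 > 0 \<and> (\<exists>\<phi>. classK (ereal r0) \<phi> \<and>
            (\<forall>x. 0 < f x \<and> f x \<le> ereal r0 \<longrightarrow>
                 lower_norm (frechet_subdiff (compK \<phi> (ereal r0) f) x) \<ge> 1)))
     \<longleftrightarrow>
         (\<exists>\<psi>. classK \<infinity> \<psi> \<and> concave_on {0..} \<psi> \<and>
            (\<forall>x. f x \<noteq> 0 \<longrightarrow> lower_norm (frechet_subdiff (compK \<psi> \<infinity> f) x) \<ge> 1))"
    (is "?local \<longleftrightarrow> ?global")
proof
  have nonneg: "0 \<le> f z" for z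
    using INF_lower[of z UNIV f] assms(4) by simp
  {
    assume ?local
    then obtain r0 \<phi> where r0: "r0 > 0" and K: "classK (ereal r0) \<phi>"
      and KL: "\<And>x p. 0 < f x \<Longrightarrow> f x \<le> ereal r0 \<Longrightarrow>
        p \<in> frechet_subdiff (compK \<phi> (ereal r0) f) x \<Longrightarrow> 1 \<le> norm p"
      by (auto simp: one_le_lower_norm_iff)
    \<comment> \<open>Any freezing level strictly between 0 and r0 would serve.\<close>
    let ?a = "r0 / 2"
    obtain \<psi> where \<psi>: "classK \<infinity> \<psi>" "concave_on {0..} \<psi>"
      and \<psi>': "\<And>r. 0 < r \<Longrightarrow> deriv \<psi> r = 1 + (INF s\<in>{0<..min r ?a}. deriv \<phi> s)"
      using classK_concave_from_lower_envelope[OF K, of ?a] r0 by auto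
    \<comment> \<open>A subgradient at an arbitrary level r is carried down to a level s below r0
      without increasing its norm; there the local inequality applies with
      \<open>deriv \<phi> s\<close>.\<close>
    have slope: "1 \<le> deriv \<phi> s * norm p"
      if x: "f x = ereal r" and p: "subgradient f x p" and s: "0 < s" "s \<le> min r ?a" for x r p s
    proof -
      obtain y q where y: "f y = ereal s" "subgradient f y q" "norm q \<le> norm p"
      proof (cases "s = r")
        case True
        then show ?thesis using that x p by blast
      next
        case False
        \<comment> \<open>The infimum 0 supplies a point strictly below level s, as the descent to
          that level requires.\<close>
        have "(INF x. f x) < ereal s" using assms(4) s by simp
        then obtain w0 where "f w0 < ereal s" by (auto simp: INF_less_iff)
        then show ?thesis
          using subgradient_at_lower_level[OF assms(1,3) nonneg _ x _ p, of w0 s] False s that by auto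
      qed
      have s_r0: "ereal s < ereal r0" using s r0 by simp
      have "deriv \<phi> s *\<^sub>R q \<in> frechet_subdiff (compK \<phi> (ereal r0) f) y"
        using subgradient_imp_frechet_subdiff_compK[OF nonneg y(1) s(1) s_r0
            classK_deriv(1)[OF K s(1) s_r0] classK_mono[OF K] y(2)] .
      then have "1 \<le> norm (deriv \<phi> s *\<^sub>R q)"
        using KL[of y] y(1) s s_r0 by (simp del: norm_scaleR)
      also have "\<dots> = deriv \<phi> s * norm q"
        using classK_deriv(2)[OF K s(1) s_r0] by simp
      also have "\<dots> \<le> deriv \<phi> s * norm p"
        using classK_deriv(2)[OF K s(1) s_r0] y(3) by simp
      finally show ?thesis .
    qed
    have "1 \<le> norm q" if fx: "f x \<noteq> 0" and q: "q \<in> frechet_subdiff (compK \<psi> \<infinity> f) x" for x q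
    proof -
      have "f x < \<infinity>" using q frechet_subdiff_compK_empty[of f x \<infinity> \<psi>] by auto
      then obtain r where r: "f x = ereal r" "0 < r"
        using nonneg[of x] fx by (cases "f x") auto
      define d where "d = deriv \<psi> r"
      have d: "(\<psi> has_real_derivative d) (at r)" "d > 0"
        using classK_deriv[OF \<psi>(1) r(2)] by (auto simp: d_def)
      have p: "subgradient f x (q /\<^sub>R d)"
        using frechet_subdiff_compK_imp_subgradient[OF assms(3) nonneg r _ d classK_mono[OF \<psi>(1)] q]
        by simp
      have inv_le: "inverse (norm (q /\<^sub>R d)) \<le> deriv \<phi> s" if "0 < s" "s \<le> min r ?a" for s
      proof -
        have *: "1 \<le> deriv \<phi> s * norm (q /\<^sub>R d)" using slope[OF r(1) p that] .
        then have "q /\<^sub>R d \<noteq> 0" by (metis mult_zero_right norm_zero not_one_le_zero)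
        then have "1 / norm (q /\<^sub>R d) \<le> deriv \<phi> s"
          using * by (subst pos_divide_le_eq) (simp_all only: zero_less_norm_iff not_False_eq_True)
        then show ?thesis by (metis inverse_eq_divide)
      qed
      have ne: "{0<..min r ?a} \<noteq> {}" using r r0 by auto
      then have "q \<noteq> 0" using slope[OF r(1) p, of "min r ?a"] r r0 by auto
      \<comment> \<open>The bound holds for every level s in the interval, so it passes to the
        infimum, which is at most d. Since the left side equals \<open>d / norm q\<close>, this
        gives \<open>1 \<le> norm q\<close>.\<close>
      have "inverse (norm (q /\<^sub>R d)) \<le> (INF s\<in>{0<..min r ?a}. deriv \<phi> s)"
        by (rule cINF_greatest[OF ne]) (use inv_le in auto)
      also have "\<dots> \<le> d" using \<psi>'[OF r(2)] by (simp add: d_def)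
      finally have "d / norm q \<le> d" using d(2) by (simp add: divide_simps)
      then show ?thesis using d(2) \<open>q \<noteq> 0\<close> by (simp add: divide_simps)
    qed
    then show ?global using \<psi> by (auto simp: one_le_lower_norm_iff)
  next
    assume ?global
    then obtain \<psi> where K: "classK \<infinity> \<psi>"
      and KL: "\<And>x p. f x \<noteq> 0 \<Longrightarrow> p \<in> frechet_subdiff (compK \<psi> \<infinity> f) x \<Longrightarrow> 1 \<le> norm p"
      by (auto simp: one_le_lower_norm_iff)
    \<comment> \<open>The local statement holds with \<open>r0 = 1\<close>, an arbitrary positive
      level, by restricting \<psi>.\<close>
    have K1: "classK (ereal 1) \<psi>"
      using K unfolding classK_def by (auto elim: continuous_on_subset)
    have "1 \<le> norm q" if fx: "0 < f x" and q: "q \<in> frechet_subdiff (compK \<psi> (ereal 1) f) x" for x q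
    proof -
      have "f x < ereal 1" using q frechet_subdiff_compK_empty[of f x "ereal 1" \<psi>] by auto
      then obtain r where r: "f x = ereal r" "0 < r" "ereal r < ereal 1"
        using fx by (cases "f x") auto
      define d where "d = deriv \<psi> r"
      have d: "(\<psi> has_real_derivative d) (at r)" "d > 0"
        using classK_deriv[OF K r(2)] by (auto simp: d_def)
      have "subgradient f x (q /\<^sub>R d)"
        using frechet_subdiff_compK_imp_subgradient[OF assms(3) nonneg r d classK_mono[OF K1] q] .
      \<comment> \<open>The truncated and the untruncated composition are compared through the
        convex subgradient of f: dividing by d and multiplying back returns the same q.\<close>
      then have "d *\<^sub>R (q /\<^sub>R d) \<in> frechet_subdiff (compK \<psi> \<infinity> f) x"
        using subgradient_imp_frechet_subdiff_compK[where f = f and x = x and rb = \<infinity>,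
            OF nonneg r(1,2) _ d(1) classK_mono[OF K]]
        by (simp del: scaleR_scaleR)
      then show ?thesis using KL[of x q] fx d(2) by simp
    qed
    then show ?local
      using K1 by (intro exI[of _ 1] conjI exI[of _ \<psi>]) (auto simp: one_le_lower_norm_iff)
  }
qed

end
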